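(* For every $0<r<2$ there exists a constant $C_r>0$, depending only on $r$, such that for all integers $N\ge2$, $$\lim_{T\to\infty}\Big(\frac1T\int_0^T\Big|\sum_{n=1}^N n^{-it}\Big|^r dt\Big)^{1/r}\ \ge\ C_r\,\frac{N^{1/2}}{(\log N)^{\frac1r-\frac12}} .$$ *)

theory Defs
  imports "HOL-Analysis.Analysis"
begin

end

theory Submission
  imports Defs
begin

text \<open>
  Write \<open>f\<close> for the Dirichlet polynomial and \<open>M g\<close> for the limit of the averages of \<open>g\<close> over
  \<open>[0, T]\<close>. The limit exists for \<open>|f|\<^sup>r = (|f|\<^sup>2)\<^bsup>r/2\<^esup>\<close> because a continuous function of the bounded
  trigonometric polynomial \<open>|f|\<^sup>2\<close> is a uniform limit of trigonometric polynomials. For the lower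
  bound, interpolate the second moment between the \<open>r\<close>-th and the fourth: averaging
  \<open>x\<^sup>2 \<le> A\<^bsup>2-r\<^esup> x\<^sup>r + x\<^sup>4 / A\<^sup>2\<close> gives \<open>N \<le> A\<^bsup>2-r\<^esup> M |f|\<^sup>r + M |f|\<^sup>4 / A\<^sup>2\<close>. The fourth moment
  counts the solutions of \<open>a b = c d\<close> in \<open>{1..N}\<close>, so it is at most \<open>6 N\<^sup>2 log N\<close>, and
  \<open>A\<^sup>2 = 12 N log N\<close> makes the last term at most \<open>N / 2\<close>.
\<close>

section \<open>Mean values over the half-line\<close>

text \<open>Continuity is built in because the integral of a non-integrable function is the junk value 0.\<close>

definition has_mean :: "(real \<Rightarrow> 'a::banach) \<Rightarrow> 'a \<Rightarrow> bool" where
  "has_mean f m \<longleftrightarrow> continuous_on UNIV f \<and>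
     ((\<lambda>T. (1 / T) *\<^sub>R integral {0..T} f) \<longlongrightarrow> m) at_top"

lemma has_mean_integrable:
  "has_mean f m \<Longrightarrow> f integrable_on {a..b}"
  unfolding has_mean_def
  by (meson continuous_on_subset integrable_continuous_real subset_UNIV)

lemma has_mean_add:
  assumes "has_mean f a" "has_mean g b"
  shows "has_mean (\<lambda>t. f t + g t) (a + b)"
proof -
  have "(\<lambda>T. (1 / T) *\<^sub>R integral {0..T} (\<lambda>t. f t + g t)) =
        (\<lambda>T. (1 / T) *\<^sub>R integral {0..T} f + (1 / T) *\<^sub>R integral {0..T} g)"
    by (simp add: integral_add has_mean_integrable[OF assms(1)]
        has_mean_integrable[OF assms(2)] scaleR_add_right)
  then show ?thesis
    using assms unfolding has_mean_def by (auto intro!: tendsto_intros continuous_intros)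
qed

text \<open>Bounded linear maps commute with the integral and with limits. This one fact yields
  scaling, negation, division and passage to real parts.\<close>

lemma has_mean_bounded_linear:
  assumes "has_mean f a" "bounded_linear h"
  shows "has_mean (\<lambda>t. h (f t)) (h a)"
proof -
  interpret bounded_linear h by fact
  have "(\<lambda>T. (1 / T) *\<^sub>R integral {0..T} (\<lambda>t. h (f t))) =
        (\<lambda>T. h ((1 / T) *\<^sub>R integral {0..T} f))"
    using integral_linear[OF has_mean_integrable[OF assms(1)] assms(2)]
    by (simp add: o_def scaleR)
  then show ?thesis
    using assms unfolding has_mean_def by (auto intro!: tendsto continuous_on)
qed

lemma has_mean_diff:
  assumes "has_mean f a" "has_mean g b"
  shows "has_mean (\<lambda>t. f t - g t) (a - b)"
  using has_mean_add[OF assms(1)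
      has_mean_bounded_linear[OF assms(2) bounded_linear_minus[OF bounded_linear_ident]]]
  by simp

lemma has_mean_0: "has_mean (\<lambda>t. 0) 0"
  by (simp add: has_mean_def)

lemma has_mean_sum:
  assumes "finite S" "\<And>s. s \<in> S \<Longrightarrow> has_mean (f s) (m s)"
  shows "has_mean (\<lambda>t. \<Sum>s\<in>S. f s t) (\<Sum>s\<in>S. m s)"
  using assms by (induction S rule: finite_induct) (auto intro: has_mean_add has_mean_0)

lemma norm_average_le:
  fixes f :: "real \<Rightarrow> 'a::banach"
  assumes "continuous_on UNIV f" "\<And>t. norm (f t) \<le> B" "T > 0"
  shows "norm ((1 / T) *\<^sub>R integral {0..T} f) \<le> B"
proof -
  have "norm (integral {0..T} f) \<le> B * (T - 0)"
    using assms by (intro integral_bound) (auto intro: continuous_on_subset)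
  then show ?thesis using assms(3) by (simp add: field_simps)
qed

lemma has_mean_norm_le:
  assumes "has_mean f m" "\<And>t. norm (f t) \<le> B"
  shows "norm m \<le> B"
proof (rule tendsto_upperbound)
  show "((\<lambda>T. norm ((1 / T) *\<^sub>R integral {0..T} f)) \<longlongrightarrow> norm m) at_top"
    by (rule tendsto_norm) (use assms(1) in \<open>simp add: has_mean_def\<close>)
  show "eventually (\<lambda>T. norm ((1 / T) *\<^sub>R integral {0..T} f) \<le> B) at_top"
    using eventually_gt_at_top[of "0::real"]
    by eventually_elim (use assms in \<open>auto simp only: has_mean_def intro!: norm_average_le\<close>)
qed simp

lemma has_mean_mono:
  fixes f g :: "real \<Rightarrow> real"
  assumes "has_mean f a" "has_mean g b" "\<And>t. f t \<le> g t"
  shows "a \<le> b"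
proof (rule tendsto_le)
  show "eventually (\<lambda>T. (1 / T) *\<^sub>R integral {0..T} f \<le> (1 / T) *\<^sub>R integral {0..T} g) at_top"
    using eventually_gt_at_top[of "0::real"]
    by eventually_elim
      (auto intro!: divide_right_mono integral_le has_mean_integrable[OF assms(1)]
        has_mean_integrable[OF assms(2)] assms(3))
qed (use assms in \<open>auto simp: has_mean_def\<close>)

text \<open>Means are 1-Lipschitz in the sup norm, so the means \<open>m n\<close> form a Cauchy
  sequence. The averages converge uniformly in \<open>T > 0\<close>, so the limits in
  \<open>n\<close> and \<open>T\<close> may be interchanged.\<close>

lemma has_mean_uniform_limit:
  fixes f :: "nat \<Rightarrow> real \<Rightarrow> 'a::banach"
  assumes lim: "uniform_limit UNIV f g sequentially"
    and f: "\<And>n. has_mean (f n) (m n)"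
  shows "\<exists>l. has_mean g l"
proof -
  have cont_f: "continuous_on UNIV (f n)" for n using f by (simp add: has_mean_def)
  have cont: "continuous_on UNIV g"
    using lim cont_f by (intro uniform_limit_theorem[OF _ lim]) auto
  have close: "\<exists>M. \<forall>n\<ge>M. \<forall>t. norm (f n t - g t) < e" if "e > 0" for e
    using uniform_limitD[OF lim that] by (auto simp: eventually_sequentially dist_norm)
  have "Cauchy m"
  proof (rule metric_CauchyI)
    fix e :: real assume "e > 0"
    \<comment> \<open>Bounds on means are only non-strict; with \<open>e / 3\<close> they give
      \<open>2 * e / 3\<close>, which is strictly below \<open>e\<close>.\<close>
    then obtain M where M: "\<And>n t. n \<ge> M \<Longrightarrow> norm (f n t - g t) < e / 3"
      using close[of "e / 3"] by auto
    show "\<exists>M. \<forall>j\<ge>M. \<forall>k\<ge>M. dist (m j) (m k) < e"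
    proof (intro exI allI impI)
      fix j k assume "j \<ge> M" "k \<ge> M"
      then have "norm (f j t - f k t) \<le> 2 * e / 3" for t
        using M[of j t] M[of k t] norm_triangle_ineq4[of "f j t - g t" "f k t - g t"] by simp
      then have "norm (m j - m k) \<le> 2 * e / 3"
        by (rule has_mean_norm_le[OF has_mean_diff[OF f f]])
      then show "dist (m j) (m k) < e" using \<open>e > 0\<close> by (simp add: dist_norm)
    qed
  qed
  then obtain l where l: "m \<longlonglongrightarrow> l" using Cauchy_convergent_iff convergentD by blast
  have "((\<lambda>T. (1 / T) *\<^sub>R integral {0..T} g) \<longlongrightarrow> l) at_top"
  proof (rule swap_uniform_limit'[OF _ l])
    show "\<forall>\<^sub>F n in sequentially. ((\<lambda>T. (1 / T) *\<^sub>R integral {0..T} (f n)) \<longlongrightarrow> m n) at_top"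
      using f by (simp add: has_mean_def)
    show "\<forall>\<^sub>F T in at_top. T \<in> {0::real<..}" using eventually_gt_at_top[of "0::real"] by simp
    show "uniform_limit {0<..} (\<lambda>n T. (1 / T) *\<^sub>R integral {0..T} (f n))
            (\<lambda>T. (1 / T) *\<^sub>R integral {0..T} g) sequentially"
    proof (rule uniform_limitI)
      fix e :: real assume "e > 0"
      then obtain M where M: "\<And>n t. n \<ge> M \<Longrightarrow> norm (f n t - g t) < e / 2"
        using close[of "e / 2"] by auto
      have "dist ((1 / T) *\<^sub>R integral {0..T} (f n)) ((1 / T) *\<^sub>R integral {0..T} g) < e"
        if "n \<ge> M" "T > 0" for n T
      proof -
        have "norm ((1 / T) *\<^sub>R integral {0..T} (\<lambda>t. f n t - g t)) \<le> e / 2"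
          using M[OF \<open>n \<ge> M\<close>] that cont cont_f
          by (intro norm_average_le continuous_on_diff) (auto intro: less_imp_le)
        moreover have "integral {0..T} (\<lambda>t. f n t - g t) = integral {0..T} (f n) - integral {0..T} g"
          using cont cont_f
          by (intro integral_diff integrable_continuous_real) (auto intro: continuous_on_subset)
        ultimately show ?thesis
          using \<open>e > 0\<close> by (simp add: dist_norm scaleR_diff_right)
      qed
      then show "\<forall>\<^sub>F n in sequentially. \<forall>T\<in>{0<..}.
          dist ((1 / T) *\<^sub>R integral {0..T} (f n)) ((1 / T) *\<^sub>R integral {0..T} g) < e"
        by (auto simp: eventually_sequentially)
    qed
  qed simp
  with cont show ?thesis by (auto simp: has_mean_def)
qed

text \<open>For \<open>w \<noteq> 0\<close> the antiderivative \<open>F\<close> is bounded, so the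
  averages decay like \<open>1 / T\<close>. This is the orthogonality relation behind every moment
  computed later.\<close>

lemma has_mean_character:
  "has_mean (\<lambda>t. exp (\<i> * of_real (w * t))) (if w = 0 then 1 else 0)"
proof (cases "w = 0")
  case True
  have "((\<lambda>T::real. (1 / T) *\<^sub>R integral {0..T} (\<lambda>t. 1 :: complex)) \<longlongrightarrow> 1) at_top"
  proof (rule tendsto_eventually)
    show "\<forall>\<^sub>F T in at_top. (1 / T) *\<^sub>R integral {0..T} (\<lambda>t. 1 :: complex) = 1"
      using eventually_gt_at_top[of "0::real"] by eventually_elim (simp add: scaleR_conv_of_real)
  qed
  with True show ?thesis by (simp add: has_mean_def)
next
  case False
  define F where "F = (\<lambda>t. exp (\<i> * of_real (w * t)) / (\<i> * of_real w))"
  have int: "integral {0..T} (\<lambda>t. exp (\<i> * of_real (w * t))) = F T - F 0" if "T > 0" for T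
  proof (rule integral_unique, rule fundamental_theorem_of_calculus)
    fix x assume "x \<in> {0..T}"
    have "((\<lambda>z. exp (\<i> * (of_real w * z)) / (\<i> * of_real w)) has_field_derivative
            exp (\<i> * (of_real w * of_real x))) (at (of_real x))"
      using False by (auto intro!: derivative_eq_intros simp: mult.left_commute[of \<i>])
    from has_vector_derivative_real_field[OF this]
    show "(F has_vector_derivative exp (\<i> * of_real (w * x))) (at x within {0..T})"
      by (simp add: F_def o_def has_vector_derivative_at_within)
  qed (use that in auto)
  have "((\<lambda>T. (1 / T) *\<^sub>R integral {0..T} (\<lambda>t. exp (\<i> * of_real (w * t)))) \<longlongrightarrow> 0) at_top"
  proof (rule Lim_null_comparison)
    show "((\<lambda>T. (2 / \<bar>w\<bar>) * inverse T) \<longlongrightarrow> 0) at_top"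
      by (intro tendsto_mult_right_zero tendsto_inverse_0_at_top filterlim_ident)
    have "norm (F T - F 0) \<le> 2 / \<bar>w\<bar>" for T
      using norm_triangle_ineq4[of "F T" "F 0"] by (simp add: F_def norm_divide norm_mult)
    then have bound: "norm ((1 / T) *\<^sub>R integral {0..T} (\<lambda>t. exp (\<i> * of_real (w * t)))) \<le> (2 / \<bar>w\<bar>) * inverse T"
      if "T > 0" for T
      using that int[OF that] by (simp add: divide_right_mono divide_inverse mult_left_mono)
    show "\<forall>\<^sub>F T in at_top.
        norm ((1 / T) *\<^sub>R integral {0..T} (\<lambda>t. exp (\<i> * of_real (w * t)))) \<le> (2 / \<bar>w\<bar>) * inverse T"
      using eventually_gt_at_top[of "0::real"] by eventually_elim (rule bound)
  qed
  with False show ?thesis by (auto simp: has_mean_def intro!: continuous_intros)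
qed

section \<open>Generalized trigonometric polynomials\<close>

text \<open>The complex span of the characters with arbitrary real frequencies, as the frequencies
  \<open>ln n\<close> have no common period in general. The inductive form lets closure under
  products and conjugation, and existence of the mean, follow by rule induction.\<close>

inductive trig_poly :: "(real \<Rightarrow> complex) \<Rightarrow> bool" where
  character: "trig_poly (\<lambda>t. exp (\<i> * of_real (w * t)))"
| scale: "trig_poly f \<Longrightarrow> trig_poly (\<lambda>t. c * f t)"
| add: "trig_poly f \<Longrightarrow> trig_poly g \<Longrightarrow> trig_poly (\<lambda>t. f t + g t)"

lemma trig_poly_const: "trig_poly (\<lambda>t. c)"
  using scale[OF character[of 0], of c] by simp

lemma trig_poly_sum:
  assumes "finite S" "\<And>s. s \<in> S \<Longrightarrow> trig_poly (f s)"
  shows "trig_poly (\<lambda>t. \<Sum>s\<in>S. f s t)"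
  using assms by (induction S rule: finite_induct) (auto intro: trig_poly_const trig_poly.add)

lemma trig_poly_character_mult:
  assumes "trig_poly g"
  shows "trig_poly (\<lambda>t. exp (\<i> * of_real (w * t)) * g t)"
  using assms
proof induction
  case (character v)
  show ?case using trig_poly.character[of "w + v"]
    by (simp add: mult_exp_exp algebra_simps)
next
  case (scale f c)
  then show ?case using trig_poly.scale[OF scale.IH, of c] by (simp add: mult_ac)
next
  case (add f g)
  then show ?case using trig_poly.add[OF add.IH] by (simp add: algebra_simps)
qed

lemma trig_poly_mult:
  assumes "trig_poly f" "trig_poly g"
  shows "trig_poly (\<lambda>t. f t * g t)"
  using assms
proof induction
  case (character w)
  then show ?case by (rule trig_poly_character_mult)
next
  case (scale f c)
  then show ?case using trig_poly.scale[of "\<lambda>t. f t * g t" c] by (simp add: mult_ac)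
next
  case (add f h)
  then show ?case using trig_poly.add[of "\<lambda>t. f t * g t" "\<lambda>t. h t * g t"] by (simp add: algebra_simps)
qed

lemma trig_poly_cnj:
  assumes "trig_poly f"
  shows "trig_poly (\<lambda>t. cnj (f t))"
  using assms
proof induction
  case (character w)
  then show ?case using trig_poly.character[of "-w"] by (simp add: exp_cnj)
qed (auto intro: trig_poly.intros)

lemma trig_poly_has_mean:
  assumes "trig_poly f"
  shows "\<exists>m. has_mean f m"
  using assms
proof induction
  case (character w)
  then show ?case using has_mean_character by blast
next
  case (scale f c)
  then show ?case using has_mean_bounded_linear[OF _ bounded_linear_mult_right] by blast
next
  case (add f g)
  then show ?case using has_mean_add by blast
qed

lemma trig_poly_real_polynomial:
  fixes p :: "real \<Rightarrow> real"
  assumes "real_polynomial_function p" "trig_poly (\<lambda>t. of_real (g t))"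
  shows "trig_poly (\<lambda>t. of_real (p (g t)))"
  using assms(1)
proof induction
  case (linear h)
  \<comment> \<open>A linear map on the reals is multiplication by its value at 1, so this case
    reduces to scaling.\<close>
  have "h x = h 1 * x" for x
    using linear.hyps linear_cmul[of h x 1] by (simp add: bounded_linear.linear mult.commute)
  then have "(\<lambda>t. of_real (h (g t))) = (\<lambda>t. of_real (h 1) * complex_of_real (g t))"
    by (metis of_real_mult)
  then show ?case using trig_poly.scale[OF assms(2), of "of_real (h 1)"] by simp
qed (auto intro: trig_poly_const trig_poly.add trig_poly_mult)

text \<open>By Weierstrass approximation of \<open>h\<close> and the stability of means under uniform limits.\<close>

lemma has_mean_continuous_image:
  fixes g h :: "real \<Rightarrow> real"
  assumes g: "trig_poly (\<lambda>t. of_real (g t))" "\<And>t. g t \<in> {a..b}"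
    and h: "continuous_on {a..b} h"
  shows "\<exists>m. has_mean (\<lambda>t. h (g t)) m"
proof -
  have "\<exists>p. real_polynomial_function p \<and> (\<forall>x\<in>{a..b}. \<bar>h x - p x\<bar> < 1 / real (Suc n))" for n
    using Stone_Weierstrass_real_polynomial_function[OF compact_Icc h, of "1 / real (Suc n)"]
    by (metis of_nat_0_less_iff zero_less_Suc zero_less_divide_1_iff)
  then obtain p where p: "\<And>n. real_polynomial_function (p n)"
    "\<And>n x. x \<in> {a..b} \<Longrightarrow> \<bar>h x - p n x\<bar> < 1 / real (Suc n)"
    by metis
  have "\<exists>m. has_mean (\<lambda>t. p n (g t)) m" for n
  proof -
    obtain m where "has_mean (\<lambda>t. complex_of_real (p n (g t))) m"
      using trig_poly_has_mean[OF trig_poly_real_polynomial[OF p(1) g(1)]] by blast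
    from has_mean_bounded_linear[OF this bounded_linear_Re] show ?thesis by auto
  qed
  then obtain m where m: "\<And>n. has_mean (\<lambda>t. p n (g t)) (m n)" by metis
  have "uniform_limit UNIV (\<lambda>n t. p n (g t)) (\<lambda>t. h (g t)) sequentially"
  proof (rule uniform_limitI)
    fix e :: real assume "e > 0"
    then obtain M where M: "1 / real (Suc M) < e"
      using nat_approx_posE by blast
    have "dist (p n (g t)) (h (g t)) < e" if "n \<ge> M" for n t
    proof -
      have "1 / real (Suc n) \<le> 1 / real (Suc M)" using that by (simp add: field_simps)
      then show ?thesis using p(2)[OF g(2), of t n] M by (simp add: dist_real_def)
    qed
    then show "\<forall>\<^sub>F n in sequentially. \<forall>t\<in>UNIV. dist (p n (g t)) (h (g t)) < e"
      by (auto simp: eventually_sequentially)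
  qed
  then show ?thesis using m by (rule has_mean_uniform_limit)
qed

text \<open>Expanding the square as the sum times its conjugate gives characters of frequency
  \<open>w x - w y\<close>, and only those of frequency 0 have nonzero mean. Coinciding frequencies
  are allowed, so that the fourth moment can use the same lemma with pairs as indices.\<close>

lemma has_mean_norm_square_characters:
  fixes w :: "'s \<Rightarrow> real"
  assumes "finite S"
  shows "has_mean (\<lambda>t. (cmod (\<Sum>s\<in>S. exp (\<i> * of_real (w s * t))))\<^sup>2)
           (real (card {(x, y). x \<in> S \<and> y \<in> S \<and> w x = w y}))"
proof -
  have eq: "(\<Sum>(x, y)\<in>S \<times> S. exp (\<i> * of_real ((w x - w y) * t))) =
      complex_of_real ((cmod (\<Sum>s\<in>S. exp (\<i> * of_real (w s * t))))\<^sup>2)" for t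
    unfolding complex_norm_square
    by (simp add: sum_product sum.cartesian_product exp_cnj mult_exp_exp algebra_simps)
  have "has_mean (\<lambda>t. \<Sum>z\<in>S \<times> S. exp (\<i> * of_real ((w (fst z) - w (snd z)) * t)))
      (\<Sum>z\<in>S \<times> S. if w (fst z) - w (snd z) = 0 then 1 else 0)"
    using assms by (intro has_mean_sum has_mean_character) auto
  from has_mean_bounded_linear[OF this bounded_linear_Re]
  have "has_mean (\<lambda>t. (cmod (\<Sum>s\<in>S. exp (\<i> * of_real (w s * t))))\<^sup>2)
      (Re (\<Sum>z\<in>S \<times> S. if w (fst z) - w (snd z) = 0 then 1 else 0))"
    using eq by (simp add: case_prod_unfold del: Re_sum)
  moreover have "(\<Sum>z\<in>S \<times> S. if w (fst z) - w (snd z) = 0 then 1 else 0 :: complex) =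
      of_nat (card {(x, y). x \<in> S \<and> y \<in> S \<and> w x = w y})"
  proof -
    have "{z \<in> S \<times> S. w (fst z) - w (snd z) = 0} = {(x, y). x \<in> S \<and> y \<in> S \<and> w x = w y}" by auto
    then show ?thesis using assms by (simp add: sum.If_cases Int_def)
  qed
  ultimately show ?thesis by (simp del: Re_sum)
qed

section \<open>The multiplicative energy of an initial segment\<close>

text \<open>The nesting as pairs of pairs matches the index set that arises when the square of the
  Dirichlet polynomial is expanded.\<close>

definition mult_energy :: "nat \<Rightarrow> ((nat \<times> nat) \<times> (nat \<times> nat)) set" where
  "mult_energy N = {((a, b), (c, d)). a \<in> {1..N} \<and> b \<in> {1..N} \<and> c \<in> {1..N} \<and> d \<in> {1..N}
     \<and> a * b = c * d}"

text \<open>Take \<open>g = gcd a c\<close>, so that \<open>x\<close> and \<open>y\<close> are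
  coprime; cancelling \<open>g\<close> leaves \<open>x * b = y * d\<close>, which forces
  \<open>y\<close> to divide \<open>b\<close>.\<close>

lemma mult_eq_mult_factorE:
  fixes a b c d :: nat
  assumes "a * b = c * d" "a > 0" "c > 0"
  obtains g k x y where "a = g * x" "b = k * y" "c = g * y" "d = k * x"
proof -
  define g where "g = gcd a c"
  have "g > 0" using assms by (simp add: g_def)
  then have "gcd a c \<noteq> 0" by (simp add: g_def)
  then obtain x y where "a = x * g" "c = y * g" and "coprime x y"
    using gcd_coprime_exists[of a c] unfolding g_def by blast
  then have xy: "a = g * x" "c = g * y" "coprime x y" by (simp_all only: mult.commute)
  have "x * b = y * d" using assms(1) \<open>g > 0\<close> unfolding xy(1,2) by simp
  then have "y dvd b" using xy(3) by (metis coprime_commute coprime_dvd_mult_right_iff dvd_triv_left)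
  then obtain k where k: "b = k * y" by (metis dvd_div_mult_self)
  moreover have "y > 0" using assms(3) unfolding xy(2) by simp
  ultimately have "d = k * x" using \<open>x * b = y * d\<close> by (simp add: mult.commute)
  with xy k show ?thesis by (intro that)
qed

text \<open>
  With \<open>a = g x\<close>, \<open>b = k y\<close>, \<open>c = g y\<close>, \<open>d = k x\<close>, both \<open>g\<close> and \<open>k\<close> are at most \<open>N / max x y\<close>, so the
  count is bounded by the sum of \<open>(N / max x y)\<^sup>2\<close> over \<open>x\<close> and \<open>y\<close>.
\<close>

lemma card_mult_energy_le:
  "real (card (mult_energy N)) \<le> 2 * real N ^ 2 * harm N"
proof -
  \<comment> \<open>For fixed \<open>x\<close> there are \<open>x\<close> values
    \<open>y \<le> x\<close>, each contributing \<open>1 / x^2\<close>, so the inner sum is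
    \<open>1 / x\<close>.\<close>
  have diag: "(\<Sum>x=1..N. \<Sum>y=1..N. if y \<le> x then 1 / real x ^ 2 else 0) = harm N"
    unfolding harm_def
  proof (rule sum.cong)
    fix x assume x: "x \<in> {1..N}"
    then have "{1..N} \<inter> {y. y \<le> x} = {1..x}" by auto
    then show "(\<Sum>y=1..N. if y \<le> x then 1 / real x ^ 2 else 0) = inverse (of_nat x)"
      using x by (simp add: sum.If_cases power2_eq_square field_simps)
  qed simp
  have diag': "(\<Sum>x=1..N. \<Sum>y=1..N. if x \<le> y then 1 / real y ^ 2 else 0) = harm N"
    using diag by (subst sum.swap)
  \<comment> \<open>Distinct points of \<open>P\<close> may give the same quadruple; for an upper
    bound it is enough that the image of \<open>P\<close> covers
    \<open>mult_energy N\<close>.\<close>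
  define P where "P = (SIGMA (x, y) : {1..N} \<times> {1..N}. {1..N div max x y} \<times> {1..N div max x y})"
  have "mult_energy N \<subseteq> (\<lambda>((x, y), (g, k)). ((g * x, k * y), (g * y, k * x))) ` P"
  proof (clarify)
    fix a b c d assume "((a, b), (c, d)) \<in> mult_energy N"
    then have *: "a \<in> {1..N}" "b \<in> {1..N}" "c \<in> {1..N}" "d \<in> {1..N}" "a * b = c * d"
      by (auto simp: mult_energy_def)
    then have "a > 0" "c > 0" by auto
    with *(5) obtain g k x y where eq: "a = g * x" "b = k * y" "c = g * y" "d = k * x"
      by (rule mult_eq_mult_factorE)
    have pos: "g > 0" "k > 0" "x > 0" "y > 0" using * eq by (auto intro!: Nat.gr0I)
    \<comment> \<open>The two products are the larger of \<open>a\<close> and \<open>c\<close> and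
      the larger of \<open>b\<close> and \<open>d\<close>.\<close>
    have "max x y * g \<le> N" "max x y * k \<le> N"
      using * eq by (auto simp: max_def mult.commute)
    then have "g \<le> N div max x y" "k \<le> N div max x y"
      using pos by (auto simp: less_eq_div_iff_mult_less_eq mult.commute)
    moreover have "x \<le> N" "y \<le> N" using * eq pos
      by (metis atLeastAtMost_iff dvd_imp_le dvd_triv_right le_trans mult_pos_pos)+
    ultimately have "((x, y), (g, k)) \<in> P" using pos by (auto simp: P_def)
    then show "((a, b), (c, d)) \<in> (\<lambda>((x, y), (g, k)). ((g * x, k * y), (g * y, k * x))) ` P"
      using eq by (auto intro!: image_eqI[of _ _ "((x, y), (g, k))"])
  qed
  moreover have "finite P" by (auto simp: P_def)
  ultimately have "card (mult_energy N) \<le> card P" by (rule surj_card_le[rotated])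
  also have "card P = (\<Sum>(x, y)\<in>{1..N} \<times> {1..N}. (N div max x y) * (N div max x y))"
    unfolding P_def by (subst card_SigmaI) (auto simp: case_prod_unfold)
  finally have "real (card (mult_energy N)) \<le>
      (\<Sum>x=1..N. \<Sum>y=1..N. real (N div max x y) * real (N div max x y))"
    by (simp add: sum.cartesian_product flip: of_nat_mult of_nat_sum)
  \<comment> \<open>The maximum is split according to which variable attains it. The diagonal is
    counted twice, which only weakens the bound.\<close>
  also have "\<dots> \<le> (\<Sum>x=1..N. \<Sum>y=1..N. real N ^ 2 *
      ((if y \<le> x then 1 / real x ^ 2 else 0) + (if x \<le> y then 1 / real y ^ 2 else 0)))"
  proof (intro sum_mono)
    fix x y assume "x \<in> {1..N}" "y \<in> {1..N}"
    have "real (N div max x y) * real (N div max x y) \<le> (real N / real (max x y)) * (real N / real (max x y))"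
      by (intro mult_mono of_nat_div_le_of_nat) auto
    also have "\<dots> = real N ^ 2 * (1 / real (max x y) ^ 2)" by (simp add: power2_eq_square)
    also have "\<dots> \<le> real N ^ 2 *
      ((if y \<le> x then 1 / real x ^ 2 else 0) + (if x \<le> y then 1 / real y ^ 2 else 0))"
      by (intro mult_left_mono) (auto simp: max_def)
    finally show "real (N div max x y) * real (N div max x y) \<le> \<dots>" .
  qed
  also have "\<dots> = real N ^ 2 *
     ((\<Sum>x=1..N. \<Sum>y=1..N. if y \<le> x then 1 / real x ^ 2 else 0) +
      (\<Sum>x=1..N. \<Sum>y=1..N. if x \<le> y then 1 / real y ^ 2 else 0))"
    by (simp only: sum.distrib sum_distrib_left distrib_left)
  also have "\<dots> = real N ^ 2 * (harm N + harm N)"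
    by (simp only: diag diag')
  finally show ?thesis by simp
qed

text \<open>\<open>harm N - ln N\<close> is decreasing and equals 1 at \<open>N = 1\<close>; the
  constant 1 is absorbed into \<open>2 * ln N\<close> because
  \<open>ln 2 \<ge> 1 / 2\<close>.\<close>

lemma harm_le_3_ln:
  assumes "N \<ge> 2"
  shows "harm N \<le> 3 * ln (real N)"
proof -
  have "harm N - ln (real N) \<le> harm 1 - ln (real 1)"
    using assms by (intro euler_mascheroni_sequence_decreasing) auto
  then have "harm N \<le> 1 + ln (real N)" by (simp add: harm_def)
  moreover have "1 / 2 \<le> ln (2::real)" using ln2_ge_two_thirds by simp
  moreover have "ln 2 \<le> ln (real N)" using assms by simp
  ultimately show ?thesis by linarith
qed

section \<open>The lower bound\<close>

text \<open>One term suffices on each side of the threshold \<open>A\<close>: below it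
  \<open>x powr (2 - r)\<close> is at most \<open>A powr (2 - r)\<close>, above it
  \<open>x^2 / A^2\<close> is at least 1.\<close>

lemma square_le_powr_plus_fourth_power:
  fixes x A r :: real
  assumes "x \<ge> 0" "A > 0" "r < 2"
  shows "x ^ 2 \<le> A powr (2 - r) * x powr r + x ^ 4 / A ^ 2"
proof (cases "x \<le> A")
  case True
  have "x ^ 2 \<le> A powr (2 - r) * x powr r"
  proof (cases "x = 0")
    case False
    then have "x ^ 2 = x powr (2 - r) * x powr r"
      using assms by (simp flip: powr_add)
    also have "\<dots> \<le> A powr (2 - r) * x powr r"
      using True assms by (intro mult_right_mono powr_mono2) auto
    finally show ?thesis .
  qed simp
  then show ?thesis using assms by (simp add: add_increasing2)
next
  case False
  then have "x ^ 2 * A ^ 2 \<le> x ^ 2 * x ^ 2"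
    using assms by (intro mult_left_mono power_mono) auto
  then have "x ^ 2 \<le> x ^ 4 / A ^ 2"
    using assms by (simp add: field_simps flip: power_add)
  then show ?thesis by (simp add: add_increasing)
qed

text \<open>The detour through the squared modulus is needed because \<open>f * cnj f\<close> is a
  trigonometric polynomial, while the modulus of \<open>f\<close> in general is not. The hypothesis
  \<open>r > 0\<close> makes \<open>x powr (r / 2)\<close> continuous up to \<open>x = 0\<close>,
  where \<open>f\<close> may vanish.\<close>

lemma has_mean_norm_characters_powr:
  fixes w :: "'s \<Rightarrow> real"
  assumes "finite S" "r > 0"
  shows "\<exists>m. has_mean (\<lambda>t. cmod (\<Sum>s\<in>S. exp (\<i> * of_real (w s * t))) powr r) m"
proof -
  define f where "f t = (\<Sum>s\<in>S. exp (\<i> * of_real (w s * t)))" for t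
  have "trig_poly f"
    unfolding f_def using assms(1) by (intro trig_poly_sum trig_poly.character)
  then have "trig_poly (\<lambda>t. of_real ((cmod (f t))\<^sup>2))"
    unfolding complex_norm_square by (intro trig_poly_mult trig_poly_cnj)
  moreover have "(cmod (f t))\<^sup>2 \<in> {0..(real (card S))\<^sup>2}" for t
  proof -
    have "cmod (f t) \<le> (\<Sum>s\<in>S. 1)"
      unfolding f_def by (rule order_trans[OF norm_sum]) (simp add: sum_mono)
    then show ?thesis by (auto intro: power_mono)
  qed
  moreover have "continuous_on {0..(real (card S))\<^sup>2} (\<lambda>x. x powr (r / 2))"
    using assms(2) by (intro continuous_on_powr') (auto intro: continuous_intros)
  ultimately have "\<exists>m. has_mean (\<lambda>t. (cmod (f t))\<^sup>2 powr (r / 2)) m"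
    by (rule has_mean_continuous_image)
  moreover have "(cmod z)\<^sup>2 powr (r / 2) = cmod z powr r" for z
    by (cases "z = 0") (auto simp: powr_powr simp flip: powr_numeral)
  ultimately show ?thesis by (simp add: f_def)
qed

text \<open>The square of the sum is again a sum of characters, indexed by pairs
  \<open>(a, b)\<close> with frequency \<open>- (ln a + ln b)\<close>. Its second moment counts
  coincidences of these frequencies, which by injectivity of \<open>ln\<close> are the solutions of
  \<open>a * b = c * d\<close>.\<close>

lemma has_mean_norm_fourth_power_characters:
  "has_mean (\<lambda>t. (cmod (\<Sum>n=1..N. exp (\<i> * of_real (- ln (real n) * t)))) ^ 4)
     (real (card (mult_energy N)))"
proof -
  have sq: "(\<Sum>z\<in>{1..N}\<times>{1..N}. exp (\<i> * of_real (- (ln (real (fst z)) + ln (real (snd z))) * t))) =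
      (\<Sum>n=1..N. exp (\<i> * of_real (- ln (real n) * t)))\<^sup>2" for t
    by (simp add: power2_eq_square sum_product sum.cartesian_product case_prod_unfold
        mult_exp_exp algebra_simps)
  have "(cmod ((\<Sum>n=1..N. exp (\<i> * of_real (- ln (real n) * t)))\<^sup>2))\<^sup>2 =
      (cmod (\<Sum>n=1..N. exp (\<i> * of_real (- ln (real n) * t)))) ^ 4" for t
    by (simp add: norm_power flip: power_mult)
  moreover have "{(p, q). p \<in> {1..N}\<times>{1..N} \<and> q \<in> {1..N}\<times>{1..N} \<and>
      - (ln (real (fst p)) + ln (real (snd p))) = - (ln (real (fst q)) + ln (real (snd q)))} =
      mult_energy N"
  proof -
    have "- (ln (real a) + ln (real b)) = - (ln (real c) + ln (real d)) \<longleftrightarrow> a * b = c * d"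
      if "a > 0" "b > 0" "c > 0" "d > 0" for a b c d
    proof -
      have "- (ln (real a) + ln (real b)) = - (ln (real c) + ln (real d)) \<longleftrightarrow>
          ln (real (a * b)) = ln (real (c * d))"
        using that by (auto simp: ln_mult)
      also have "\<dots> \<longleftrightarrow> a * b = c * d"
        using that by (subst ln_inj_iff) (simp_all only: of_nat_eq_iff of_nat_0_less_iff nat_0_less_mult_iff)
      finally show ?thesis .
    qed
    then show ?thesis unfolding mult_energy_def by fastforce
  qed
  ultimately show ?thesis
    using has_mean_norm_square_characters[of "{1..N}\<times>{1..N}"
        "\<lambda>z. - (ln (real (fst z)) + ln (real (snd z)))"]
    unfolding sq by simp
qed

lemma mean_powr_characters_ge:
  assumes "r > 0" "r < 2" "N \<ge> 2"
    and m: "has_mean (\<lambda>t. cmod (\<Sum>n=1..N. exp (\<i> * of_real (- ln (real n) * t))) powr r) m"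
  shows "m \<ge> real N / 2 * (12 * real N * ln (real N)) powr (r / 2 - 1)"
proof -
  define f where "f t = (\<Sum>n=1..N. exp (\<i> * of_real (- ln (real n) * t)))" for t
  \<comment> \<open>The factor 12 is twice the 6 obtained from the factor 2 in the energy bound and
    the factor 3 in \<open>harm_le_3_ln\<close>.\<close>
  define B where "B = 12 * real N * ln (real N)"
  define A where "A = sqrt B"
  have "B > 0" using assms by (simp add: B_def)
  then have "A > 0" "A ^ 2 = B" by (auto simp: A_def)
  have "{(x, y). x \<in> {1..N} \<and> y \<in> {1..N} \<and> - ln (real x) = - ln (real y)} = (\<lambda>x. (x, x)) ` {1..N}"
    by auto
  then have "card {(x, y). x \<in> {1..N} \<and> y \<in> {1..N} \<and> - ln (real x) = - ln (real y)} = N"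
    by (simp add: card_image inj_on_def)
  then have mean2: "has_mean (\<lambda>t. (cmod (f t)) ^ 2) (real N)"
    using has_mean_norm_square_characters[of "{1..N}" "\<lambda>n. - ln (real n)"] by (simp add: f_def)
  have "has_mean (\<lambda>t. A powr (2 - r) * cmod (f t) powr r + cmod (f t) ^ 4 / A ^ 2)
      (A powr (2 - r) * m + real (card (mult_energy N)) / A ^ 2)"
    using m has_mean_norm_fourth_power_characters[of N] unfolding f_def
    by (intro has_mean_add has_mean_bounded_linear[OF _ bounded_linear_mult_right]
        has_mean_bounded_linear[OF _ bounded_linear_divide])
  with mean2 have "real N \<le> A powr (2 - r) * m + real (card (mult_energy N)) / A ^ 2"
    by (rule has_mean_mono) (use \<open>A > 0\<close> assms in \<open>auto intro: square_le_powr_plus_fourth_power\<close>)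
  moreover have "real (card (mult_energy N)) / A ^ 2 \<le> real N / 2"
  proof -
    have "real (card (mult_energy N)) \<le> 2 * real N ^ 2 * harm N" by (rule card_mult_energy_le)
    also have "\<dots> \<le> 2 * real N ^ 2 * (3 * ln (real N))"
      using assms by (intro mult_left_mono harm_le_3_ln) auto
    also have "\<dots> = real N / 2 * A ^ 2"
      unfolding \<open>A ^ 2 = B\<close> B_def by (simp add: power2_eq_square)
    finally show ?thesis using \<open>A > 0\<close> by (simp add: divide_le_eq)
  qed
  ultimately have "real N / 2 \<le> A powr (2 - r) * m" by linarith
  also have "A powr (2 - r) = B powr (1 - r / 2)"
    using \<open>B > 0\<close> by (simp add: A_def powr_powr field_simps flip: powr_half_sqrt)
  finally have "real N / 2 \<le> B powr (1 - r / 2) * m" .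
  \<comment> \<open>The two exponents of \<open>B\<close> are opposite, so this multiplication
    isolates \<open>m\<close>.\<close>
  then have "real N / 2 * B powr (r / 2 - 1) \<le> (B powr (1 - r / 2) * m) * B powr (r / 2 - 1)"
    by (intro mult_right_mono) auto
  also have "\<dots> = m * (B powr (1 - r / 2) * B powr (r / 2 - 1))" by (simp add: mult_ac)
  also have "B powr (1 - r / 2) * B powr (r / 2 - 1) = 1"
    using \<open>B > 0\<close> by (simp flip: powr_add)
  finally show ?thesis by (simp add: B_def)
qed

theorem proposition3p1:
  fixes r :: real
  assumes "0 < r" and "r < 2"
  shows "\<exists>C>0. \<forall>N::nat. N \<ge> 2 \<longrightarrow>
    (\<exists>L::real.
      ((\<lambda>T::real. ((1 / T) * integral {0..T}
          (\<lambda>t::real. cmod (\<Sum>n=1..N. of_nat n powr (- (\<i> * of_real t))) powr r)) powr (1 / r))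
        \<longlongrightarrow> L) at_top \<and>
      L \<ge> C * real N powr (1 / 2) / ln (real N) powr (1 / r - 1 / 2))"
proof -
  \<comment> \<open>\<open>D\<close> collects the numerical factors of the lower bound for the mean,
    and \<open>C\<close> is what remains of them after the root of order \<open>r\<close>.\<close>
  define D :: real where "D = 12 powr (r / 2 - 1) / 2"
  define C where "C = D powr (1 / r)"
  have "D > 0" by (simp add: D_def)
  have "\<exists>L. ((\<lambda>T. ((1 / T) * integral {0..T}
          (\<lambda>t. cmod (\<Sum>n=1..N. of_nat n powr (- (\<i> * of_real t))) powr r)) powr (1 / r))
        \<longlongrightarrow> L) at_top \<and> L \<ge> C * real N powr (1 / 2) / ln (real N) powr (1 / r - 1 / 2)"
    if "N \<ge> 2" for N :: nat
  proof -
    have N: "real N > 0" "ln (real N) > 0" using that by auto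
    \<comment> \<open>Since \<open>n \<ge> 1\<close>, the complex power unfolds to an exponential
      with the real logarithm.\<close>
    have eq: "(\<Sum>n=1..N. of_nat n powr (- (\<i> * of_real t))) =
        (\<Sum>n=1..N. exp (\<i> * of_real (- ln (real n) * t)))" for t
      by (intro sum.cong) (auto simp: powr_def Ln_of_nat mult_ac)
    obtain m where m: "has_mean (\<lambda>t. cmod (\<Sum>n=1..N. exp (\<i> * of_real (- ln (real n) * t))) powr r) m"
      using has_mean_norm_characters_powr[of "{1..N}" r "\<lambda>n. - ln (real n)"] assms by auto
    have ge: "real N / 2 * (12 * real N * ln (real N)) powr (r / 2 - 1) \<le> m"
      using assms that m by (intro mean_powr_characters_ge)
    have pos: "0 < real N / 2 * (12 * real N * ln (real N)) powr (r / 2 - 1)" using N by simp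
    have exps: "(r / 2 - 1) / r = - (1 / r - 1 / 2)" "1 / r + (r / 2 - 1) / r = 1 / 2"
      using assms by (auto simp: field_simps)
    have "real N / 2 * (12 * real N * ln (real N)) powr (r / 2 - 1) =
        D * (real N * real N powr (r / 2 - 1)) * ln (real N) powr (r / 2 - 1)"
      using N by (simp add: D_def powr_mult)
    also have "\<dots> powr (1 / r) = C * (real N powr (1 / r) * real N powr ((r / 2 - 1) / r)) *
        ln (real N) powr ((r / 2 - 1) / r)"
      using N \<open>D > 0\<close> by (simp add: powr_mult powr_powr C_def)
    also have "\<dots> = C * real N powr (1 / 2) / ln (real N) powr (1 / r - 1 / 2)"
      unfolding powr_add[symmetric] unfolding exps powr_minus_divide by simp
    finally have "C * real N powr (1 / 2) / ln (real N) powr (1 / r - 1 / 2) \<le> m powr (1 / r)"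
      using ge pos assms powr_mono2[of "1 / r" "real N / 2 * (12 * real N * ln (real N)) powr (r / 2 - 1)" m]
      by simp
    moreover have "((\<lambda>T. ((1 / T) * integral {0..T}
          (\<lambda>t. cmod (\<Sum>n=1..N. of_nat n powr (- (\<i> * of_real t))) powr r)) powr (1 / r))
        \<longlongrightarrow> m powr (1 / r)) at_top"
      \<comment> \<open>\<open>ge\<close> and \<open>pos\<close> give \<open>m > 0\<close>;
        \<open>tendsto_powr\<close> requires a nonzero limit of the base.\<close>
      unfolding eq using m ge pos unfolding has_mean_def real_scaleR_def
      by (intro tendsto_powr tendsto_const) auto
    ultimately show ?thesis by blast
  qed
  moreover have "C > 0" using \<open>D > 0\<close> by (simp add: C_def)
  ultimately show ?thesis by blast
qed

end
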